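(* Let $p$ be an odd prime, $e\ge1$, $q=p^{2e}$, and let $n\ge 2$ be an integer. Let $$M_1(n,0,0)=\frac{1}{(n-1)!}\,\Big|\Big\{(x_1,\dots,x_n)\in\mathbb{F}_q^n:\ x_i\neq x_j\ \text{for all } 1\le i\ne j\le n-1,\ \sum_{1\le i<j\le n}x_ix_j=0,\ \sum_{i=1}^n x_i=0\Big\}\Big|,$$ i.e. the number of pairs $(A,x_n)$ with $A=\{x_1,\dots,x_{n-1}\}$ an $(n-1)$-element subset of $\mathbb{F}_q$ and $x_n\in\mathbb{F}_q$ such that $x_1,\dots,x_n$ satisfy the two displayed equations. (i) If $p\nmid n$, then $$M_1(n,0,0)=\frac{1}{q}\binom{q}{n-1}+\frac{q-1}{2q}\big(\alpha(n-1)+(-1)^{n-1}\beta(n-1)\big).$$ (ii) If $p\mid n$, then $$M_1(n,0,0)=\frac{1}{q}\binom{q}{n-1}+\frac{q-1}{2\sqrt{q}}\big(\alpha(n-1)-(-1)^{n-1}\beta(n-1)\big).$$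
   Context: Here $\sqrt{q}=p^e$, and for an integer $m\ge0$, $$\alpha(m)=\sum_{\substack{i+pj=m\\ 0\le i\le\sqrt{q},\ j\ge 0}}\binom{\sqrt{q}}{i}\binom{\frac{q-\sqrt{q}}{p}}{j},\qquad \beta(m)=\sum_{\substack{i+pj=m\\ i\ge 0,\ j\ge 0}}(-1)^j\binom{\sqrt{q}-1+i}{\sqrt{q}-1}\binom{\frac{q+\sqrt{q}}{p}}{j}.$$ *)

theory Defs
  imports Complex_Main "HOL-Library.FuncSet" "HOL-Library.Cardinality" "HOL-Computational_Algebra.Primes"
begin

text \<open>
  Throughout, \<open>q = p ^ (2 * e)\<close> and \<open>\<surd>q = p ^ e\<close>. For \<open>p > 0\<close> and \<open>e > 0\<close> the divisions by \<open>p\<close>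
  below are exact, as is the truncated subtraction, and the index sets are finite.
\<close>

definition alpha :: "nat \<Rightarrow> nat \<Rightarrow> nat \<Rightarrow> nat" where
  "alpha p e m =
    (\<Sum>(i, j) | i + p * j = m \<and> i \<le> p ^ e.
      (p ^ e choose i) * (((p ^ (2 * e) - p ^ e) div p) choose j))"

definition beta :: "nat \<Rightarrow> nat \<Rightarrow> nat \<Rightarrow> int" where
  "beta p e m =
    (\<Sum>(i, j) | i + p * j = m.
      (-1) ^ j * int ((p ^ e - 1 + i) choose (p ^ e - 1)) *
      int (((p ^ (2 * e) + p ^ e) div p) choose j))"

lemma finite_alpha_index: "p > 0 \<Longrightarrow> finite {(i, j). i + p * j = m \<and> i \<le> p ^ e}" for p e m :: nat
  by (rule finite_subset[of _ "{..m} \<times> {..m}"]) (auto simp: trans_le_add2)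

lemma finite_beta_index: "p > 0 \<Longrightarrow> finite {(i, j). i + p * j = m}" for p m :: nat
  by (rule finite_subset[of _ "{..m} \<times> {..m}"]) (auto simp: trans_le_add2)

lemma alpha_beta_dvd:
  fixes p e :: nat
  assumes "e \<ge> 1"
  shows "p dvd p ^ (2 * e) - p ^ e" and "p dvd p ^ (2 * e) + p ^ e"
  using assms by (auto intro!: dvd_diff_nat dvd_add dvd_power)

text \<open>
  The tuples \<open>(x\<^sub>1, \<dots>, x\<^sub>n)\<close> over the field \<open>'a\<close>, as extensional functions on \<open>{1..n}\<close>; only the
  first \<open>n - 1\<close> entries are required to be pairwise distinct.
\<close>

definition M1_tuples :: "nat \<Rightarrow> 'a::field \<Rightarrow> 'a \<Rightarrow> (nat \<Rightarrow> 'a) set" where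
  "M1_tuples n a b = {x \<in> {1..n} \<rightarrow>\<^sub>E UNIV.
     (\<forall>i\<in>{1..n-1}. \<forall>j\<in>{1..n-1}. i \<noteq> j \<longrightarrow> x i \<noteq> x j) \<and>
     (\<Sum>(i, j) | 1 \<le> i \<and> i < j \<and> j \<le> n. x i * x j) = a \<and>
     (\<Sum>i=1..n. x i) = b}"

definition M1 :: "nat \<Rightarrow> 'a::{field,finite} \<Rightarrow> 'a \<Rightarrow> real" where
  "M1 n a b = real (card (M1_tuples n a b)) / fact (n - 1)"

end

theory Submission
  imports Defs "HOL-Number_Theory.Residues" "HOL-Computational_Algebra.Polynomial_FPS"
    "HOL-Computational_Algebra.Formal_Laurent_Series"
begin

text \<open>
  Eliminating $x_n$ turns the count into that of the $m$-subsets $A$, $m = n - 1$, with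
  $\sum_{a \in A} a^2 + (\sum_{a \in A} a)^2 = 0$. Let $\psi$ be a nontrivial additive
  character of the field. Expanding the condition with the sums over $t$ of $\psi(t \cdot)$ and
  completing the square against the Gauss sum $G(t) = \sum_x \psi(t x^2)$, the square of the element
  sum disappears, at the price of a factor $G(nt) / G(t)$, and what is left is the coefficient of $X^m$ in
  $\prod_x (1 + \psi(t x^2) X)$.

  Every element of the prime field is a square, so $G(ct) = G(t)$ for nonzero $c$ in the prime field.
  Hence $G(nt) / G(t)$ is $1$ or $q / G(t)$, the values of $\psi(t x^2)$ other than $1$ are
  equidistributed, and the product is $(1 + X)^{G(t)} (1 + X^p)^{(q - G(t)) / p}$.
  Moreover $G(t)^2 = q$ and $\sum_t G(t) = q$, so $G(t)$ takes each of the values $\pm p^e$ for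
  half of the nonzero $t$; the two signs produce \<open>alpha\<close> and \<open>beta\<close>.
\<close>

section \<open>Finite fields\<close>

lemma CHAR_eq_prime:
  assumes "prime p" and "CARD('a::{field,finite}) = p ^ d"
  shows "CHAR('a) = p"
proof -
  have "prime CHAR('a)"
    using prime_CHAR_semidom finite_imp_CHAR_pos by (metis finite_class.finite_UNIV)
  moreover have "CHAR('a) dvd p ^ d"
    using CHAR_dvd_CARD[where 'a='a] assms(2) by simp
  ultimately show ?thesis
    using assms(1) by (meson prime_dvd_power primes_dvd_imp_eq)
qed

text \<open>Multiplication by a nonzero x permutes the nonzero elements, so their product absorbs
  the factor x ^ (q - 1).\<close>

lemma power_card_minus_one_eq_one:
  fixes x :: "'a::{field,finite}"
  assumes "x \<noteq> 0"
  shows "x ^ (CARD('a) - 1) = 1"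
proof -
  have "bij_betw ((*) x) (UNIV - {0}) (UNIV - {0})"
    by (rule bij_betw_byWitness[of _ "\<lambda>y. y / x"]) (use assms in auto)
  then have "(\<Prod>y\<in>UNIV - {0}. x * y) = \<Prod>(UNIV - {0})"
    by (rule prod.reindex_bij_betw)
  then show ?thesis
    by (simp add: prod.distrib card_Diff_singleton)
qed

lemma power_card_eq_self:
  fixes x :: "'a::{field,finite}"
  shows "x ^ CARD('a) = x"
proof (cases "x = 0")
  case False
  have "x ^ CARD('a) = x * x ^ (CARD('a) - 1)"
    by (metis Suc_pred' power_Suc zero_less_card_finite)
  also have "x ^ (CARD('a) - 1) = 1"
    using False by (rule power_card_minus_one_eq_one)
  finally show ?thesis
    by simp
qed simp

lemma of_nat_power_CHAR:
  assumes "prime CHAR('a::comm_semiring_1)"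
  shows "(of_nat k :: 'a) ^ CHAR('a) = of_nat k"
  using assms by (induction k) (simp_all add: freshmans_dream prime_gt_0_nat zero_power)

text \<open>With p the characteristic, the p residues are already p distinct roots of X ^ p - X,
  which leaves no room for others.\<close>

lemma prime_field_eq_roots:
  fixes x :: "'a::{field,finite}"
  assumes "prime CHAR('a)" and "x ^ CHAR('a) = x"
  shows "\<exists>k<CHAR('a). x = of_nat k"
proof -
  let ?p = "CHAR('a)"
  define f :: "'a poly" where "f = monom 1 ?p - monom 1 1"
  have p1: "?p > 1"
    using assms(1) prime_gt_1_nat by blast
  have deg: "degree f \<le> ?p"
    unfolding f_def using p1 by (intro degree_diff_le) (auto simp: degree_monom_eq)
  have "coeff f ?p \<noteq> 0"
    unfolding f_def using p1 by simp
  then have "f \<noteq> 0"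
    by auto
  have roots: "{y. poly f y = 0} = {y. y ^ ?p = y}"
    by (auto simp: f_def poly_monom)
  have sub: "of_nat ` {..<?p} \<subseteq> {y::'a. y ^ ?p = y}"
    using of_nat_power_CHAR[OF assms(1)] by auto
  have "inj_on (of_nat :: nat \<Rightarrow> 'a) {..<?p}"
    by (auto simp: inj_on_def of_nat_eq_iff_cong_CHAR cong_def)
  then have "card ((of_nat :: nat \<Rightarrow> 'a) ` {..<?p}) = ?p"
    by (simp add: card_image)
  moreover have "card {y::'a. y ^ ?p = y} \<le> ?p"
    using card_poly_roots_bound[OF \<open>f \<noteq> 0\<close>] deg by (simp add: roots)
  ultimately have "of_nat ` {..<?p} = {y::'a. y ^ ?p = y}"
    using sub by (intro card_seteq) auto
  with assms(2) show ?thesis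
    by auto
qed

text \<open>The witness is the trace to the prime field.\<close>
lemma exists_additive_functional:
  assumes "prime p" and "d > 0" and card: "CARD('a::{field,finite}) = p ^ d"
  shows "\<exists>\<tau>::'a \<Rightarrow> nat. (\<forall>x. \<tau> x < p) \<and>
    (\<forall>x y. [\<tau> (x + y) = \<tau> x + \<tau> y] (mod p)) \<and> (\<exists>x. \<tau> x \<noteq> 0)"
proof -
  have char: "CHAR('a) = p"
    using CHAR_eq_prime[OF assms(1) card] .
  define tr :: "'a \<Rightarrow> 'a" where "tr x = (\<Sum>i<d. x ^ (p ^ i))" for x
  have add: "tr (x + y) = tr x + tr y" for x y
    unfolding tr_def using assms(1) char
    by (simp add: freshmans_dream'[where 'a='a] sum.distrib)
  have "tr x ^ p = tr x" for x
  proof -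
    have "tr x ^ p = (\<Sum>i<d. x ^ (p ^ Suc i))"
      unfolding tr_def using assms(1) char
      by (simp add: freshmans_dream_sum[where 'a='a] power_mult[symmetric] mult.commute)
    \<comment> \<open>Frobenius shifts the summands of the trace by one place; the one that enters,
      x ^ (p ^ d), equals the one that leaves, x.\<close>
    also have "\<dots> + x ^ (p ^ 0) = tr x + x ^ (p ^ d)"
      unfolding tr_def
      using sum.lessThan_Suc_shift[of "\<lambda>i. x ^ (p ^ i)" d] sum.lessThan_Suc[of "\<lambda>i. x ^ (p ^ i)" d]
      by (simp only: add.commute)
    finally show ?thesis
      using power_card_eq_self[of x] by (simp add: card)
  qed
  then have "\<forall>x. \<exists>k<p. tr x = of_nat k"
    using prime_field_eq_roots[where 'a='a] assms(1) char by metis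
  then obtain \<tau> where \<tau>: "\<And>x. \<tau> x < p" "\<And>x. tr x = of_nat (\<tau> x)"
    by metis
  have "\<exists>x. tr x \<noteq> 0"
  proof (rule ccontr)
    assume "\<not> ?thesis"
    then have zero: "tr x = 0" for x
      by blast
    \<comment> \<open>A trace vanishing everywhere would give a nonzero polynomial of degree at most
      p ^ (d - 1) with p ^ d roots.\<close>
    define f :: "'a poly" where "f = (\<Sum>i<d. monom 1 (p ^ i))"
    have p1: "p > 1"
      using assms(1) prime_gt_1_nat by blast
    have "coeff f (p ^ (d - 1)) = (\<Sum>i<d. if i = d - 1 then 1 else 0)"
      unfolding f_def coeff_sum using p1 by (intro sum.cong) auto
    then have "f \<noteq> 0"
      using assms(2) by auto
    have "degree f \<le> p ^ (d - 1)"
      unfolding f_def using p1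
      by (intro degree_sum_le) (auto intro!: power_increasing simp: degree_monom_eq)
    moreover have "{x. poly f x = 0} = UNIV"
      using zero by (simp add: f_def poly_sum poly_monom tr_def)
    ultimately have "p ^ d \<le> p ^ (d - 1)"
      using card_poly_roots_bound[OF \<open>f \<noteq> 0\<close>] card by simp
    then show False
      using p1 assms(2) by simp
  qed
  then have "\<exists>x. \<tau> x \<noteq> 0"
    using \<tau>(2) by (metis of_nat_0)
  moreover have "[\<tau> (x + y) = \<tau> x + \<tau> y] (mod p)" for x y
    using add[of x y] \<tau>(2) char
    by (metis of_nat_add of_nat_eq_iff_cong_CHAR)
  ultimately show ?thesis
    using \<tau>(1) by blast
qed

text \<open>Elements of the prime field satisfy Euler's criterion because $(q-1)/(p-1)$ is even.\<close>
lemma of_nat_is_square: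
  assumes "prime p" and "odd p" and "e \<ge> 1" and card: "CARD('a::{field,finite}) = p ^ (2 * e)"
  shows "\<exists>d::'a. d ^ 2 = of_nat k"
proof (cases "(of_nat k :: 'a) = 0")
  case False
  have char: "CHAR('a) = p"
    using CHAR_eq_prime[OF assms(1) card] .
  define h where "h = (p ^ (2 * e) - 1) div 2"
  have p1: "p > 1"
    using assms(1) prime_gt_1_nat by blast
  have q1: "p ^ (2 * e) > 1"
    using p1 assms(3) by (intro one_less_power) auto
  have h2: "2 * h = p ^ (2 * e) - 1"
    unfolding h_def using assms(2) by simp
  have h0: "h > 0"
    using h2 q1 by simp
  have half: "(p ^ e - 1) * (p ^ e + 1) = p ^ (2 * e) - 1"
    by (simp add: algebra_simps power_add mult_2_right)
  have "even (p ^ e + 1)"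
    using assms(2) by simp
  then obtain r where r: "p ^ e + 1 = 2 * r"
    by blast
  have "(p - 1) dvd (p ^ e - 1)"
    using p1 cong_pow[of p 1 "p - 1" e] by (simp add: cong_altdef_nat)
  then obtain s where s: "p ^ e - 1 = (p - 1) * s"
    by blast
  have hs: "h = (p - 1) * (s * r)"
    using half h2 unfolding r s by simp
  have "(of_nat k :: 'a) ^ (p - 1) = 1"
  proof -
    have "(of_nat k :: 'a) * of_nat k ^ (p - 1) = of_nat k"
      using of_nat_power_CHAR[where 'a='a] char assms(1) p1
      by (metis Suc_pred' less_trans power_Suc zero_less_one)
    with False show ?thesis
      by simp
  qed
  then have root: "(of_nat k :: 'a) ^ h = 1"
    unfolding hs power_mult by simp
  define f :: "'a poly" where "f = monom 1 h - 1"
  have "coeff f h \<noteq> 0"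
    unfolding f_def using h0 by simp
  then have "f \<noteq> 0"
    by auto
  have deg: "degree f \<le> h"
    unfolding f_def by (intro degree_diff_le) (auto simp: degree_monom_eq)
  have roots: "{y. poly f y = 0} = {y. y ^ h = 1}"
    by (auto simp: f_def poly_monom)
  let ?S = "(\<lambda>y::'a. y ^ 2) ` (UNIV - {0})"
  have sub: "?S \<subseteq> {y. y ^ h = 1}"
    using power_card_minus_one_eq_one[where 'a='a] h2 card by (auto simp: power_mult[symmetric])
  \<comment> \<open>Squaring is at most two to one, so there are at least h nonzero squares, while X
    ^ h - 1 has at most h roots: every such root is a square.\<close>
  have "card (UNIV - {0::'a}) \<le> (\<Sum>s\<in>?S. card {y \<in> UNIV - {0}. y ^ 2 = s})"
    by (rule order.trans[OF card_mono card_UN_le]) auto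
  also have "\<dots> \<le> (\<Sum>s\<in>?S. 2)"
  proof (rule sum_mono)
    fix s assume "s \<in> ?S"
    then obtain z where z: "s = z ^ 2"
      by blast
    have "{y \<in> UNIV - {0}. y ^ 2 = s} \<subseteq> {z, - z}"
      unfolding z by (auto simp: power2_eq_iff)
    then have "card {y \<in> UNIV - {0}. y ^ 2 = s} \<le> card {z, - z}"
      by (intro card_mono) auto
    also have "\<dots> \<le> 2"
      by (simp add: card_insert_if)
    finally show "card {y \<in> UNIV - {0}. y ^ 2 = s} \<le> 2" .
  qed
  finally have "2 * h \<le> 2 * card ?S"
    using h2 card by (simp add: card_Diff_singleton)
  then have "?S = {y. y ^ h = 1}"
    using sub card_poly_roots_bound[OF \<open>f \<noteq> 0\<close>] deg
    by (intro card_seteq) (auto simp: roots)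
  with root have "of_nat k \<in> ?S"
    by simp
  then show ?thesis
    by (metis imageE)
qed (rule exI[of _ 0], simp)

section \<open>Coefficients of formal power series\<close>

lemma fps_nth_one_plus_X_power:
  "fps_nth ((1 + fps_X) ^ n :: 'a::field_char_0 fps) k = of_nat (n choose k)"
  by (simp add: fps_binomial_of_nat[symmetric] binomial_gbinomial)

text \<open>Allows powers of 1 + X to be cancelled from the relation that determines
  \<open>gen_fun\<close>.\<close>

lemma one_plus_X_power_neq_0: "(1 + fps_X) ^ n \<noteq> (0 :: 'a::field_char_0 fps)"
proof
  assume "(1 + fps_X) ^ n = (0 :: 'a fps)"
  then have "fps_nth ((1 + fps_X) ^ n :: 'a fps) 0 = 0"
    by simp
  then show False
    unfolding fps_nth_one_plus_X_power by simp
qed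

text \<open>Substitute X ^ d for X in the binomial expansion; \<open>d > 0\<close> gives the
  substituted series constant term zero.\<close>

lemma fps_nth_one_plus_X_power_power:
  assumes "d > 0"
  shows "fps_nth ((1 + fps_X ^ d) ^ N :: 'a::field_char_0 fps) n =
    (if d dvd n then of_nat (N choose (n div d)) else 0)"
proof -
  have "(1 + fps_X ^ d) ^ N = ((1 + fps_X) ^ N :: 'a fps) oo fps_X ^ d"
    using assms by (simp add: fps_compose_power[symmetric] fps_compose_add_distrib)
  then show ?thesis
    by (simp add: fps_nth_compose_X_power fps_nth_one_plus_X_power)
qed

text \<open>Brings the Cauchy product into the index form of \<open>alpha\<close> and
  \<open>beta\<close>, with j the remaining exponent divided by d.\<close>

lemma fps_nth_mult_one_plus_X_power_power:
  fixes F :: "'a::field_char_0 fps"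
  assumes "d > 0"
  shows "fps_nth (F * (1 + fps_X ^ d) ^ N) m =
    (\<Sum>(i, j) | i + d * j = m. fps_nth F i * of_nat (N choose j))"
proof -
  have "fps_nth (F * (1 + fps_X ^ d) ^ N) m =
      (\<Sum>i\<in>{0..m}. if d dvd m - i then fps_nth F i * of_nat (N choose ((m - i) div d)) else 0)"
    unfolding fps_mult_nth using assms
    by (intro sum.cong) (auto simp: fps_nth_one_plus_X_power_power)
  also have "\<dots> = (\<Sum>i\<in>{i \<in> {0..m}. d dvd m - i}. fps_nth F i * of_nat (N choose ((m - i) div d)))"
    by (intro sum.inter_filter[symmetric]) simp
  also have "\<dots> = (\<Sum>(i, j) | i + d * j = m. fps_nth F i * of_nat (N choose j))"
    by (rule sum.reindex_bij_witness[of _ fst "\<lambda>i. (i, (m - i) div d)"]) (use assms in auto)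
  finally show ?thesis .
qed

text \<open>Expanding the product picks the linear term on a subset B and 1 elsewhere, which
  contributes in degree \<open>card B\<close>.\<close>

lemma fps_nth_prod_linear:
  fixes f :: "'b \<Rightarrow> 'a::comm_ring_1"
  assumes "finite A"
  shows "fps_nth (\<Prod>x\<in>A. 1 + fps_const (f x) * fps_X) m = (\<Sum>B | B \<subseteq> A \<and> card B = m. \<Prod>x\<in>B. f x)"
proof -
  have const: "(\<Prod>x\<in>B. fps_const (f x)) = fps_const (\<Prod>x\<in>B. f x)" for B
    by (induction B rule: infinite_finite_induct) auto
  have "(\<Prod>x\<in>A. 1 + fps_const (f x) * fps_X) = (\<Sum>B\<in>Pow A. fps_const (\<Prod>x\<in>B. f x) * fps_X ^ card B)"
    using prod_add[OF assms, of "\<lambda>x. fps_const (f x) * fps_X" "\<lambda>_. 1"]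
    by (simp add: add.commute prod.distrib const)
  then have "fps_nth (\<Prod>x\<in>A. 1 + fps_const (f x) * fps_X) m =
      (\<Sum>B\<in>Pow A. if card B = m then \<Prod>x\<in>B. f x else 0)"
    by (simp add: fps_sum_nth fps_X_power_nth eq_commute[of m] cong: if_cong)
      (intro sum.cong; auto)
  also have "\<dots> = (\<Sum>B\<in>{B \<in> Pow A. card B = m}. \<Prod>x\<in>B. f x)"
    using assms by (intro sum.inter_filter[symmetric]) auto
  finally show ?thesis
    by simp
qed

lemma alpha_eq_fps_nth:
  assumes "p > 0"
  shows "of_nat (alpha p e m) =
    fps_nth ((1 + fps_X) ^ (p ^ e) * (1 + fps_X ^ p) ^ ((p ^ (2 * e) - p ^ e) div p) :: 'a::field_char_0 fps) m"
proof -
  \<comment> \<open>The bound on i in \<open>alpha\<close> may be dropped, since the binomial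
    coefficient vanishes beyond it.\<close>
  have "alpha p e m = (\<Sum>(i, j) | i + p * j = m.
      (p ^ e choose i) * (((p ^ (2 * e) - p ^ e) div p) choose j))"
    unfolding alpha_def using assms finite_beta_index[of p m]
    by (intro sum.mono_neutral_left) (auto simp: binomial_eq_0)
  then show ?thesis
    using assms
    by (simp add: fps_nth_mult_one_plus_X_power_power fps_nth_one_plus_X_power case_prod_unfold)
qed

text \<open>Negation of the upper index, followed by the symmetry of binomial coefficients.\<close>

lemma gbinomial_minus_of_nat:
  assumes "n > 0"
  shows "(- of_nat n :: 'a::field_char_0) gchoose i = (-1) ^ i * of_nat ((n - 1 + i) choose (n - 1))"
proof -
  have "(- of_nat n :: 'a) gchoose i = (-1) ^ i * (of_nat (n - 1 + i) gchoose i)"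
    using assms by (simp add: gbinomial_minus of_nat_diff add.commute algebra_simps)
  also have "(of_nat (n - 1 + i) gchoose i :: 'a) = of_nat ((n - 1 + i) choose i)"
    by (simp only: binomial_gbinomial)
  also have "(n - 1 + i) choose i = (n - 1 + i) choose (n - 1)"
    by (subst binomial_symmetric) auto
  finally show ?thesis .
qed

text \<open>For m = i + p * j with p odd, (-1) ^ m = (-1) ^ i * (-1) ^ j. The second sign cancels
  the one in \<open>beta\<close>; the first belongs to the coefficients of (1 + X) ^ (- p ^
  e).\<close>

lemma beta_eq_fps_nth:
  assumes "odd p"
  shows "(-1) ^ m * of_int (beta p e m) =
    fps_nth (fps_binomial (- of_nat (p ^ e)) * (1 + fps_X ^ p) ^ ((p ^ (2 * e) + p ^ e) div p)
      :: 'a::field_char_0 fps) m"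
proof -
  have p0: "p > 0"
    using assms by (rule odd_pos)
  have sign: "(-1) ^ (i + p * j) * (-1) ^ j = ((-1) ^ i :: 'a)" for i j
  proof -
    have "(-1 :: 'a) ^ (p * j) = (-1) ^ j"
      using assms by (simp add: power_mult)
    then show ?thesis
      by (simp add: power_add mult.assoc flip: power_mult_distrib)
  qed
  show ?thesis
    unfolding beta_def fps_nth_mult_one_plus_X_power_power[OF p0] of_int_sum sum_distrib_left
    using p0 by (intro sum.cong)
      (auto simp: gbinomial_minus_of_nat sign mult.assoc[symmetric] simp del: of_nat_power)
qed

section \<open>Quadratic character sums\<close>

text \<open>\<tau> is a nonzero homomorphism from the additive group to the integers mod p, recorded
  by least residues; \<open>exists_additive_functional\<close> supplies one.\<close>

locale quadratic_character_sums =
  fixes p e :: nat and \<tau> :: "'a::{field,finite} \<Rightarrow> nat"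
  assumes prime_p: "prime p" and odd_p: "odd p" and e_ge_1: "e \<ge> 1"
    and card_field: "CARD('a) = p ^ (2 * e)"
    and \<tau>_less: "\<tau> x < p"
    and \<tau>_add: "[\<tau> (x + y) = \<tau> x + \<tau> y] (mod p)"
    and \<tau>_nonzero: "\<exists>x. \<tau> x \<noteq> 0"
begin

section \<open>Arithmetic of the prime field\<close>

lemma char_field: "CHAR('a) = p"
  using prime_p card_field by (rule CHAR_eq_prime)

lemma p_gt_1: "p > 1"
  using prime_p by (rule prime_gt_1_nat)

lemma of_nat_field_eq_0_iff: "(of_nat k :: 'a) = 0 \<longleftrightarrow> p dvd k"
  by (simp add: of_nat_eq_0_iff_char_dvd char_field)

lemma two_neq_0: "(2 :: 'a) \<noteq> 0"
proof
  assume "(2 :: 'a) = 0"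
  then have "p dvd 2"
    using of_nat_field_eq_0_iff[of 2] by simp
  then show False
    using odd_p p_gt_1 by (auto dest!: dvd_imp_le simp: le_Suc_eq numeral_2_eq_2)
qed

lemma minus_one_eq_of_nat: "(- 1 :: 'a) = of_nat (p - 1)"
  using of_nat_CHAR[where 'a='a] p_gt_1 by (simp add: char_field of_nat_diff)

lemma square_root_of_nat:
  assumes "\<not> p dvd k"
  obtains d :: 'a where "d \<noteq> 0" "d ^ 2 = of_nat k"
proof -
  obtain d :: 'a where d: "d ^ 2 = of_nat k"
    using of_nat_is_square[OF prime_p odd_p e_ge_1 card_field] by blast
  moreover have "(of_nat k :: 'a) \<noteq> 0"
    using assms by (simp add: of_nat_field_eq_0_iff)
  ultimately have "d \<noteq> 0"
    by (metis zero_power2)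
  with d that show ?thesis
    by blast
qed

lemma \<tau>_of_nat_mult: "[\<tau> (of_nat k * x) = k * \<tau> x] (mod p)"
proof (induction k)
  case 0
  have "[\<tau> 0 + 0 = \<tau> 0 + \<tau> 0] (mod p)"
    using \<tau>_add[of 0 0] by simp
  then have "[\<tau> 0 = 0] (mod p)"
    using cong_add_lcancel_nat cong_sym by metis
  then show ?case
    by simp
next
  case (Suc k)
  have "[\<tau> (x + of_nat k * x) = \<tau> x + \<tau> (of_nat k * x)] (mod p)"
    by (rule \<tau>_add)
  also have "[\<tau> x + \<tau> (of_nat k * x) = \<tau> x + k * \<tau> x] (mod p)"
    using Suc by (intro cong_add) auto
  finally show ?case
    by (simp add: algebra_simps)
qed

section \<open>The additive character and its orthogonality relation\<close>

definition \<zeta> :: complex where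
  "\<zeta> = cis (2 * pi / p)"

definition \<psi> :: "'a \<Rightarrow> complex" where
  "\<psi> x = \<zeta> ^ \<tau> x"

lemma \<zeta>_power: "\<zeta> ^ k = cis (2 * pi * real k / real p)"
  by (simp add: \<zeta>_def DeMoivre field_simps)

lemma \<zeta>_power_p: "\<zeta> ^ p = 1"
  using p_gt_1 by (simp add: \<zeta>_power)

lemma \<zeta>_power_cong:
  assumes "[i = j] (mod p)"
  shows "\<zeta> ^ i = \<zeta> ^ j"
proof -
  have "\<zeta> ^ k = \<zeta> ^ (k mod p)" for k
  proof -
    have "\<zeta> ^ k = \<zeta> ^ (p * (k div p) + k mod p)"
      by simp
    then show ?thesis
      unfolding power_add power_mult \<zeta>_power_p by simp
  qed
  then show ?thesis
    using assms unfolding cong_def by metis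
qed

lemma \<zeta>_power_inj: "inj_on ((^) \<zeta>) {..<p}"
  using bij_betw_roots_unity[of p] p_gt_1 unfolding bij_betw_def \<zeta>_power[symmetric] by auto

lemma \<zeta>_neq_1: "\<zeta> \<noteq> 1"
  using inj_onD[OF \<zeta>_power_inj, of 0 1] p_gt_1 by auto

lemma \<psi>_add: "\<psi> (x + y) = \<psi> x * \<psi> y"
  unfolding \<psi>_def using \<zeta>_power_cong[OF \<tau>_add] by (simp add: power_add)

lemma \<psi>_0 [simp]: "\<psi> 0 = 1"
  unfolding \<psi>_def using \<zeta>_power_cong[OF \<tau>_of_nat_mult[of 0 0]] by simp

lemma \<psi>_sum: "\<psi> (\<Sum>i\<in>I. f i) = (\<Prod>i\<in>I. \<psi> (f i))"
  by (induction I rule: infinite_finite_induct) (auto simp: \<psi>_add)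

text \<open>For t nonzero, shifting x by z / t multiplies the sum by \<open>\<psi> z\<close>, and z
  is chosen such that this differs from 1; so the sum vanishes.\<close>

lemma sum_\<psi>_mult: "(\<Sum>x\<in>UNIV. \<psi> (t * x)) = (if t = 0 then of_nat (p ^ (2 * e)) else 0)"
proof (cases "t = 0")
  case True
  then show ?thesis
    by (simp add: card_field)
next
  case False
  obtain z where z: "\<tau> z \<noteq> 0"
    using \<tau>_nonzero by blast
  have neq: "\<psi> z \<noteq> 1"
    unfolding \<psi>_def using inj_onD[OF \<zeta>_power_inj, of "\<tau> z" 0] z \<tau>_less p_gt_1 by auto
  have "(\<Sum>x\<in>UNIV. \<psi> (t * x)) = (\<Sum>x\<in>UNIV. \<psi> (t * (x + z / t)))"
    by (rule sum.reindex_bij_witness[of _ "\<lambda>x. x + z / t" "\<lambda>x. x - z / t"]) auto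
  also have "\<dots> = (\<Sum>x\<in>UNIV. \<psi> z * \<psi> (t * x))"
    using False by (simp add: algebra_simps \<psi>_add)
  also have "\<dots> = \<psi> z * (\<Sum>x\<in>UNIV. \<psi> (t * x))"
    by (simp add: sum_distrib_left)
  finally show ?thesis
    using neq False by simp
qed

section \<open>Quadratic Gauss sums: values up to sign and distribution of the signs\<close>

definition gauss_sum :: "'a \<Rightarrow> complex" where
  "gauss_sum t = (\<Sum>x\<in>UNIV. \<psi> (t * x ^ 2))"

lemma gauss_sum_0: "gauss_sum 0 = of_nat (p ^ (2 * e))"
  by (simp add: gauss_sum_def card_field)

text \<open>k has a nonzero square root d in the field, and multiplication by d permutes the
  field.\<close>

lemma gauss_sum_of_nat_mult:
  assumes "\<not> p dvd k"
  shows "gauss_sum (of_nat k * t) = gauss_sum t"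
proof -
  obtain d :: 'a where "d \<noteq> 0" and d: "d ^ 2 = of_nat k"
    using square_root_of_nat[OF assms] .
  then have "bij ((*) d)"
    by (intro bij_betw_byWitness[of _ "\<lambda>x. x / d"]) auto
  then have "(\<Sum>x\<in>UNIV. \<psi> (t * (d * x) ^ 2)) = gauss_sum t"
    unfolding gauss_sum_def by (rule sum.reindex_bij_betw)
  then show ?thesis
    unfolding gauss_sum_def d[symmetric] by (simp add: power_mult_distrib mult_ac)
qed

text \<open>-1 lies in the prime field as p - 1, hence is a square. As passing from t to -t
  conjugates the sum, all these Gauss sums are real.\<close>

lemma gauss_sum_minus: "gauss_sum (- t) = gauss_sum t"
proof -
  have "\<not> p dvd p - 1"
    using p_gt_1 by (auto dest: dvd_imp_le)
  then have "gauss_sum (- 1 * t) = gauss_sum t"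
    unfolding minus_one_eq_of_nat by (rule gauss_sum_of_nat_mult)
  then show ?thesis
    by simp
qed

text \<open>One factor is replaced by the sum at -t. Putting x = u + y makes the exponent linear in
  y, and orthogonality leaves only u = 0, because 2 * t is nonzero.\<close>

lemma gauss_sum_square:
  assumes "t \<noteq> 0"
  shows "gauss_sum t ^ 2 = of_nat (p ^ (2 * e))"
proof -
  have "gauss_sum t ^ 2 = gauss_sum t * gauss_sum (- t)"
    by (simp add: gauss_sum_minus power2_eq_square)
  also have "\<dots> = (\<Sum>y\<in>UNIV. \<Sum>x\<in>UNIV. \<psi> (t * x ^ 2 - t * y ^ 2))"
    unfolding gauss_sum_def sum_product
    by (subst sum.swap) (simp add: \<psi>_add[symmetric])
  also have "\<dots> = (\<Sum>y\<in>UNIV. \<Sum>u\<in>UNIV. \<psi> (t * u ^ 2 + (2 * t * u) * y))"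
  proof (rule sum.cong[OF refl])
    fix y
    show "(\<Sum>x\<in>UNIV. \<psi> (t * x ^ 2 - t * y ^ 2)) = (\<Sum>u\<in>UNIV. \<psi> (t * u ^ 2 + (2 * t * u) * y))"
      by (rule sum.reindex_bij_witness[of _ "\<lambda>u. u + y" "\<lambda>x. x - y"])
        (auto simp: power2_eq_square algebra_simps)
  qed
  also have "\<dots> = (\<Sum>u\<in>UNIV. \<psi> (t * u ^ 2) * (\<Sum>y\<in>UNIV. \<psi> ((2 * t * u) * y)))"
    by (subst sum.swap) (simp add: \<psi>_add sum_distrib_left)
  also have "\<dots> = (\<Sum>u\<in>(UNIV :: 'a set). if u = 0 then of_nat (p ^ (2 * e)) else 0)"
    using assms two_neq_0 by - (rule sum.cong[OF refl], subst sum_\<psi>_mult, auto)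
  finally show ?thesis
    by simp
qed

lemma gauss_sum_cases:
  assumes "t \<noteq> 0"
  shows "gauss_sum t = of_nat (p ^ e) \<or> gauss_sum t = - of_nat (p ^ e)"
proof -
  have "gauss_sum t ^ 2 = of_nat (p ^ e) ^ 2"
    using gauss_sum_square[OF assms] by (simp add: power_mult[symmetric] mult.commute)
  then show ?thesis
    using power2_eq_iff by blast
qed

text \<open>If t is summed first, orthogonality leaves only the x with x ^ 2 = 0.\<close>

lemma sum_gauss_sum: "(\<Sum>t\<in>UNIV. gauss_sum t) = of_nat (p ^ (2 * e))"
proof -
  have "(\<Sum>t\<in>UNIV. gauss_sum t) = (\<Sum>x\<in>UNIV. \<Sum>t\<in>UNIV. \<psi> (x ^ 2 * t))"
    unfolding gauss_sum_def by (subst sum.swap) (simp add: mult.commute)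
  also have "\<dots> = (\<Sum>x\<in>(UNIV :: 'a set). if x = 0 then of_nat (p ^ (2 * e)) else 0)"
    by (rule sum.cong[OF refl]) (simp add: sum_\<psi>_mult)
  finally show ?thesis
    by simp
qed

definition gauss_pos :: "'a set" where
  "gauss_pos = {t. t \<noteq> 0 \<and> gauss_sum t = of_nat (p ^ e)}"

definition gauss_neg :: "'a set" where
  "gauss_neg = {t. t \<noteq> 0 \<and> gauss_sum t = - of_nat (p ^ e)}"

lemma sum_split_gauss:
  "(\<Sum>t\<in>UNIV. f t) = f 0 + (\<Sum>t\<in>gauss_pos. f t) + (\<Sum>t\<in>gauss_neg. f t :: 'b::comm_monoid_add)"
proof -
  have UNIV_eq: "UNIV = insert 0 (gauss_pos \<union> gauss_neg)"
    using gauss_sum_cases by (auto simp: gauss_pos_def gauss_neg_def)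
  have disjoint: "gauss_pos \<inter> gauss_neg = {}"
    using p_gt_1 by (auto simp: gauss_pos_def gauss_neg_def)
  have "0 \<notin> gauss_pos \<union> gauss_neg"
    by (auto simp: gauss_pos_def gauss_neg_def)
  then have "(\<Sum>t\<in>UNIV. f t) = f 0 + (\<Sum>t\<in>gauss_pos \<union> gauss_neg. f t)"
    unfolding UNIV_eq by (intro sum.insert) auto
  also have "(\<Sum>t\<in>gauss_pos \<union> gauss_neg. f t) = (\<Sum>t\<in>gauss_pos. f t) + (\<Sum>t\<in>gauss_neg. f t)"
    using disjoint by (intro sum.union_disjoint) auto
  finally show ?thesis
    by (simp add: add.assoc)
qed

text \<open>The term at t = 0 accounts for the whole of \<open>sum_gauss_sum\<close>, so the values
  p ^ e and - p ^ e must balance.\<close>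

lemma card_gauss:
  "2 * card gauss_pos = p ^ (2 * e) - 1" "2 * card gauss_neg = p ^ (2 * e) - 1"
proof -
  have "(\<Sum>t\<in>gauss_pos. gauss_sum t) + (\<Sum>t\<in>gauss_neg. gauss_sum t) = 0"
    using sum_split_gauss[of gauss_sum] sum_gauss_sum gauss_sum_0 by simp
  then have "(of_nat (card gauss_pos) - of_nat (card gauss_neg)) * of_nat (p ^ e) = (0 :: complex)"
    by (simp add: gauss_pos_def gauss_neg_def algebra_simps)
  then have "card gauss_pos = card gauss_neg"
    using p_gt_1 by simp
  moreover have "p ^ (2 * e) = 1 + card gauss_pos + card gauss_neg"
    using sum_split_gauss[of "\<lambda>_. 1 :: nat"] by (simp add: card_field)
  ultimately show "2 * card gauss_pos = p ^ (2 * e) - 1" "2 * card gauss_neg = p ^ (2 * e) - 1"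
    by simp_all
qed

section \<open>Distribution of the character values and the generating function\<close>

lemma prod_\<zeta>_power: "(\<Prod>k<p. 1 + fps_const (\<zeta> ^ k) * fps_X) = 1 + fps_X ^ p"
proof -
  define f g :: "complex poly"
    where "f = (\<Prod>k<p. [:1, \<zeta> ^ k:])" and "g = monom 1 p + 1"
  have neq0: "\<zeta> \<noteq> 0"
    by (simp add: \<zeta>_def)
  have deg_f: "degree f = p"
    unfolding f_def using neq0 by (subst degree_prod_eq_sum_degree) auto
  \<comment> \<open>The exponents add up to p * (p - 1) / 2, a multiple of p because p is
    odd.\<close>
  have "lead_coeff f = \<zeta> ^ (\<Sum>k<p. k)"
    unfolding f_def lead_coeff_prod using neq0 by (simp add: power_sum)
  also have "\<dots> = 1"
  proof -
    obtain r where "p = Suc (2 * r)"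
      using odd_p by (metis oddE Suc_eq_plus1)
    then have "(\<Sum>k<p. k) = p * r"
      by (simp add: lessThan_Suc_atMost atMost_atLeast0 gauss_sum_nat)
    then show ?thesis
      by (simp add: power_mult \<zeta>_power_p)
  qed
  finally have lead: "coeff f p = 1"
    by (simp add: deg_f)
  \<comment> \<open>Degrees at most p and equal coefficients at X ^ p reduce the identity to the p
    points - \<zeta> ^ k, where both sides vanish.\<close>
  have "f = g"
  proof (rule poly_eqI_degree_lead_coeff[of _ p _ "(\<lambda>k. - (\<zeta> ^ k)) ` {..<p}"])
    show "coeff f p = coeff g p"
      using lead p_gt_1 by (simp add: g_def)
    have "inj_on (\<lambda>k. - (\<zeta> ^ k)) {..<p}"
      using \<zeta>_power_inj by (auto simp: inj_on_def)
    then show "p \<le> card ((\<lambda>k. - (\<zeta> ^ k)) ` {..<p})"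
      by (simp add: card_image)
    show "degree g \<le> p"
      unfolding g_def by (intro degree_add_le) (auto simp: degree_monom_eq)
    fix z assume "z \<in> (\<lambda>k. - (\<zeta> ^ k)) ` {..<p}"
    then obtain j where j: "j < p" "z = - (\<zeta> ^ j)"
      by auto
    \<comment> \<open>\<zeta> ^ k is the inverse of \<zeta> ^ j; the reduction mod p covers j =
      0.\<close>
    define k where "k = (p - j) mod p"
    have "[k + j = p] (mod p)"
      using j(1) by (simp add: k_def cong_def mod_add_left_eq)
    then have "\<zeta> ^ k * \<zeta> ^ j = 1"
      using \<zeta>_power_cong[of "k + j" p] by (simp add: power_add \<zeta>_power_p)
    then have "poly [:1, \<zeta> ^ k:] z = 0"
      by (simp add: j(2) mult.commute)
    moreover have "k < p"
      using p_gt_1 by (simp add: k_def)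
    ultimately have "poly f z = 0"
      unfolding f_def poly_prod by (intro prod_zero) auto
    moreover have "(\<zeta> ^ j) ^ p = 1"
      by (metis \<zeta>_power_p mult.commute power_mult power_one)
    then have "z ^ p = - 1"
      using odd_p by (simp add: j(2))
    ultimately show "poly f z = poly g z"
      by (simp add: g_def poly_monom)
  qed (simp add: deg_f)
  have linear: "fps_of_poly [:1, c:] = 1 + fps_const c * fps_X" for c :: complex
    by (simp add: fps_of_poly_pCons)
  have "fps_of_poly f = (\<Prod>k<p. 1 + fps_const (\<zeta> ^ k) * fps_X)"
    unfolding f_def fps_of_poly_prod linear ..
  moreover have "fps_of_poly g = 1 + fps_X ^ p"
    by (simp add: g_def fps_of_poly_add fps_of_poly_monom')
  ultimately show ?thesis
    using \<open>f = g\<close> by simp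
qed

text \<open>For k < p this is the multiplicity of \<zeta> ^ k among the values \<psi> (t * x ^
  2).\<close>

definition fibre_card :: "'a \<Rightarrow> nat \<Rightarrow> nat" where
  "fibre_card t k = card {x. \<tau> (t * x ^ 2) = k}"

text \<open>Scaling $x$ by a square root of $k$ maps the fibre over $1$ onto the fibre over $k$.\<close>
lemma fibre_card_eq:
  assumes "0 < k" "k < p"
  shows "fibre_card t k = fibre_card t 1"
proof -
  have nd: "\<not> p dvd k"
    using assms by (auto dest: dvd_imp_le)
  obtain d :: 'a where d0: "d \<noteq> 0" and d: "d ^ 2 = of_nat k"
    using square_root_of_nat[OF nd] .
  have cop: "coprime k p"
    using nd prime_p prime_imp_coprime_nat coprime_commute by blast
  have iff: "\<tau> (t * (d * x) ^ 2) = k \<longleftrightarrow> \<tau> (t * x ^ 2) = 1" for x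
  proof -
    have "[\<tau> (t * (d * x) ^ 2) = k * \<tau> (t * x ^ 2)] (mod p)"
      using \<tau>_of_nat_mult[of k "t * x ^ 2"] by (simp add: power_mult_distrib d mult_ac)
    then have "[\<tau> (t * (d * x) ^ 2) = k] (mod p) \<longleftrightarrow> [k * \<tau> (t * x ^ 2) = k * 1] (mod p)"
      by (metis cong_sym cong_trans mult_1_right)
    also have "\<dots> \<longleftrightarrow> [\<tau> (t * x ^ 2) = 1] (mod p)"
      using cop by (rule cong_mult_lcancel_nat)
    \<comment> \<open>All numbers compared are residues below p, so the congruences are
      equalities.\<close>
    finally show ?thesis
      using assms p_gt_1 \<tau>_less by (simp add: cong_def)
  qed
  have "bij_betw ((*) d) {x. \<tau> (t * x ^ 2) = 1} {x. \<tau> (t * x ^ 2) = k}"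
  proof (rule bij_betw_byWitness[of _ "\<lambda>x. x / d"])
    show "(*) d ` {x. \<tau> (t * x ^ 2) = 1} \<subseteq> {x. \<tau> (t * x ^ 2) = k}"
      using iff by blast
    show "(\<lambda>x. x / d) ` {x. \<tau> (t * x ^ 2) = k} \<subseteq> {x. \<tau> (t * x ^ 2) = 1}"
    proof (intro image_subsetI CollectI)
      fix y assume "y \<in> {x. \<tau> (t * x ^ 2) = k}"
      then show "\<tau> (t * (y / d) ^ 2) = 1"
        using iff[of "y / d"] d0 by simp
    qed
  qed (use d0 in simp_all)
  then show ?thesis
    unfolding fibre_card_def by (metis bij_betw_same_card)
qed

lemma lessThan_p_eq_insert: "{..<p} = insert 0 {1..<p}"
  using p_gt_1 by auto

lemma fibre_card_sum: "fibre_card t 0 + (p - 1) * fibre_card t 1 = p ^ (2 * e)"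
proof -
  have "p ^ (2 * e) = (\<Sum>k<p. \<Sum>x | x \<in> UNIV \<and> \<tau> (t * x ^ 2) = k. 1)"
    using \<tau>_less by (subst sum.group) (auto simp: card_field)
  also have "\<dots> = (\<Sum>k<p. fibre_card t k)"
    by (simp add: fibre_card_def)
  also have "\<dots> = fibre_card t 0 + (\<Sum>k\<in>{1..<p}. fibre_card t k)"
    by (simp add: lessThan_p_eq_insert)
  also have "(\<Sum>k\<in>{1..<p}. fibre_card t k) = (\<Sum>k\<in>{1..<p}. fibre_card t 1)"
    by (intro sum.cong refl fibre_card_eq) auto
  finally show ?thesis
    by simp
qed

text \<open>The fibres over nonzero residues have equal size, and the p-th roots of unity other than
  1 add up to -1. With \<open>fibre_card_sum\<close> this recovers both fibre sizes from the Gauss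
  sum.\<close>

lemma gauss_sum_fibre_card: "gauss_sum t = of_nat (fibre_card t 0) - of_nat (fibre_card t 1)"
proof -
  have "(\<Sum>k<p. \<zeta> ^ k) = 0"
    using geometric_sum[OF \<zeta>_neq_1, of p] by (simp add: \<zeta>_power_p)
  then have geom: "(\<Sum>k\<in>{1..<p}. \<zeta> ^ k) = - 1"
    by (simp add: lessThan_p_eq_insert add_eq_0_iff)
  have "gauss_sum t = (\<Sum>k<p. \<Sum>x | x \<in> UNIV \<and> \<tau> (t * x ^ 2) = k. \<psi> (t * x ^ 2))"
    unfolding gauss_sum_def using \<tau>_less by (subst sum.group) auto
  also have "\<dots> = (\<Sum>k<p. of_nat (fibre_card t k) * \<zeta> ^ k)"
    unfolding fibre_card_def \<psi>_def by (intro sum.cong refl) simp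
  also have "\<dots> = of_nat (fibre_card t 0) + (\<Sum>k\<in>{1..<p}. of_nat (fibre_card t k) * \<zeta> ^ k)"
    by (simp add: lessThan_p_eq_insert)
  also have "(\<Sum>k\<in>{1..<p}. of_nat (fibre_card t k) * \<zeta> ^ k) = (\<Sum>k\<in>{1..<p}. of_nat (fibre_card t 1) * \<zeta> ^ k)"
    by (intro sum.cong refl arg_cong2[of _ _ _ _ "(*)"] arg_cong[of _ _ of_nat] fibre_card_eq) auto
  finally show ?thesis
    unfolding sum_distrib_left[symmetric] geom by simp
qed

definition gen_fun :: "'a \<Rightarrow> complex fps" where
  "gen_fun t = (\<Prod>x\<in>UNIV. 1 + fps_const (\<psi> (t * x ^ 2)) * fps_X)"

text \<open>In effect \<open>gen_fun t\<close> is (1 + X) ^ G * (1 + X ^ p) ^ N for G =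
  \<open>gauss_sum t\<close> and N = \<open>fibre_card t 1\<close>. As G may be negative, a power of
  1 + X is moved to the left to keep the exponents natural.\<close>

lemma gen_fun_fibre_card:
  "gen_fun t * (1 + fps_X) ^ fibre_card t 1 = (1 + fps_X) ^ fibre_card t 0 * (1 + fps_X ^ p) ^ fibre_card t 1"
proof -
  let ?L = "\<lambda>k. 1 + fps_const (\<zeta> ^ k) * fps_X"
  have cyc: "1 + fps_X ^ p = (1 + fps_X) * (\<Prod>k\<in>{1..<p}. ?L k)"
    using prod_\<zeta>_power by (simp add: lessThan_p_eq_insert)
  have "gen_fun t = (\<Prod>k<p. \<Prod>x | x \<in> UNIV \<and> \<tau> (t * x ^ 2) = k. ?L (\<tau> (t * x ^ 2)))"
    unfolding gen_fun_def \<psi>_def using \<tau>_less by (subst prod.group) auto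
  also have "\<dots> = (\<Prod>k<p. ?L k ^ fibre_card t k)"
    unfolding fibre_card_def by (intro prod.cong refl) simp
  also have "\<dots> = (1 + fps_X) ^ fibre_card t 0 * (\<Prod>k\<in>{1..<p}. ?L k ^ fibre_card t k)"
    by (simp add: lessThan_p_eq_insert)
  also have "(\<Prod>k\<in>{1..<p}. ?L k ^ fibre_card t k) = (\<Prod>k\<in>{1..<p}. ?L k ^ fibre_card t 1)"
    by (intro prod.cong refl arg_cong2[of _ _ _ _ "(^)"] fibre_card_eq) auto
  finally show ?thesis
    unfolding cyc by (simp add: prod_power_distrib power_mult_distrib mult_ac)
qed

text \<open>For the fibre sizes N0 over 0 and N1 over 1, N0 - N1 = p ^ e and N0 + (p - 1) * N1 = q.
  Hence N1 = (q - p ^ e) / p, the exponent occurring in \<open>alpha\<close>.\<close>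

lemma gen_fun_gauss_pos:
  assumes "t \<in> gauss_pos"
  shows "fps_nth (gen_fun t) m = of_nat (alpha p e m)"
proof -
  have "(of_nat (fibre_card t 0) :: complex) = of_nat (fibre_card t 1 + p ^ e)"
    using assms gauss_sum_fibre_card[of t] by (simp add: gauss_pos_def algebra_simps)
  then have N0: "fibre_card t 0 = fibre_card t 1 + p ^ e"
    by (rule of_nat_eq_iff[THEN iffD1])
  have "p * fibre_card t 1 + p ^ e = p ^ (2 * e)"
    using fibre_card_sum[of t] p_gt_1 by (simp add: N0 algebra_simps)
  then have N1: "(p ^ (2 * e) - p ^ e) div p = fibre_card t 1"
    using p_gt_1 by (metis add_diff_cancel_right' nonzero_mult_div_cancel_left not_one_less_zero)
have "gen_fun t * (1 + fps_X) ^ fibre_card t 1 =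
      (1 + fps_X) ^ (p ^ e) * (1 + fps_X ^ p) ^ fibre_card t 1 * (1 + fps_X) ^ fibre_card t 1"
    unfolding gen_fun_fibre_card N0 by (simp add: power_add mult_ac)
  then have "gen_fun t = (1 + fps_X) ^ (p ^ e) * (1 + fps_X ^ p) ^ fibre_card t 1"
    using mult_right_cancel[OF one_plus_X_power_neq_0] by blast
  then show ?thesis
    using p_gt_1 by (simp add: alpha_eq_fps_nth N1)
qed

text \<open>Here N1 - N0 = p ^ e, so N1 = (q + p ^ e) / p and 1 + X is left with the exponent - p ^
  e, which calls for a binomial series.\<close>

lemma gen_fun_gauss_neg:
  assumes "t \<in> gauss_neg"
  shows "fps_nth (gen_fun t) m = (- 1) ^ m * of_int (beta p e m)"
proof -
  have "(of_nat (fibre_card t 1) :: complex) = of_nat (fibre_card t 0 + p ^ e)"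
    using assms gauss_sum_fibre_card[of t] by (simp add: gauss_neg_def algebra_simps)
  then have N1': "fibre_card t 1 = fibre_card t 0 + p ^ e"
    by (rule of_nat_eq_iff[THEN iffD1])
  have p_mult: "p * fibre_card t 1 = fibre_card t 1 + (p - 1) * fibre_card t 1"
    using p_gt_1 by (cases p) simp_all
  have "fibre_card t 0 + p ^ e + (p - 1) * fibre_card t 1 = p ^ (2 * e) + p ^ e"
    using fibre_card_sum[of t] by simp
  then have "p * fibre_card t 1 = p ^ (2 * e) + p ^ e"
    using p_mult N1' by linarith
  then have N1: "(p ^ (2 * e) + p ^ e) div p = fibre_card t 1"
    using p_gt_1 by (metis nonzero_mult_div_cancel_left not_one_less_zero)
have "gen_fun t * (1 + fps_X) ^ (p ^ e) * (1 + fps_X) ^ fibre_card t 0 =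
      (1 + fps_X ^ p) ^ fibre_card t 1 * (1 + fps_X) ^ fibre_card t 0"
    using gen_fun_fibre_card[of t] N1' by (simp add: power_add mult_ac)
  then have eq: "gen_fun t * (1 + fps_X) ^ (p ^ e) = (1 + fps_X ^ p) ^ fibre_card t 1"
    using mult_right_cancel[OF one_plus_X_power_neq_0] by blast
  have inv: "fps_binomial (- of_nat (p ^ e)) * (1 + fps_X) ^ (p ^ e) = (1 :: complex fps)"
    unfolding fps_binomial_of_nat[symmetric] fps_binomial_add_mult[symmetric] by simp
  have "gen_fun t = fps_binomial (- of_nat (p ^ e)) * (1 + fps_X) ^ (p ^ e) * gen_fun t"
    unfolding inv by simp
  also have "\<dots> = fps_binomial (- of_nat (p ^ e)) * (1 + fps_X ^ p) ^ fibre_card t 1"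
    unfolding eq[symmetric] by (simp only: mult_ac)
  finally have "gen_fun t = fps_binomial (- of_nat (p ^ e)) * (1 + fps_X ^ p) ^ fibre_card t 1" .
  then show ?thesis
    using beta_eq_fps_nth[OF odd_p, where 'a=complex] by (simp add: N1)
qed

section \<open>Character sums over subsets of fixed size\<close>

lemma fps_nth_gen_fun:
  "fps_nth (gen_fun t) m = (\<Sum>A | card A = m. \<Prod>a\<in>A. \<psi> (t * a ^ 2))"
  unfolding gen_fun_def by (simp add: fps_nth_prod_linear)

text \<open>Translation by y permutes the subsets with m elements. This removes y from the subset
  sum once the square has been completed.\<close>

lemma fps_nth_gen_fun_translate:
  "(\<Sum>A | card A = m. \<Prod>a\<in>A. \<psi> (t * (a + y) ^ 2)) = fps_nth (gen_fun t) m"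
proof -
  have inj: "inj_on (\<lambda>a. a + y) A" for A :: "'a set"
    by (simp add: inj_on_def)
  have "bij_betw ((`) (\<lambda>a. a + y)) {A. card A = m} {A. card A = m}"
    by (rule bij_betw_byWitness[of _ "(`) (\<lambda>a. a - y)"])
      (auto simp: image_image card_image[OF inj] card_image[of "\<lambda>a. a - y"] inj_on_def)
  then have "(\<Sum>A | card A = m. \<Prod>a\<in>(\<lambda>a. a + y) ` A. \<psi> (t * a ^ 2)) = fps_nth (gen_fun t) m"
    unfolding fps_nth_gen_fun by (rule sum.reindex_bij_betw)
  then show ?thesis
    by (simp add: prod.reindex[OF inj])
qed

text \<open>
  The Gauss sum linearises the square of the element sum of $A$: completing the square
  turns the extra summation variable into a translation of $A$.
\<close>
lemma gauss_sum_mult_quadratic_sum: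
  "gauss_sum t * (\<Sum>A | card A = m. \<psi> (t * ((\<Sum>a\<in>A. a ^ 2) + (\<Sum>a\<in>A. a) ^ 2))) =
    fps_nth (gen_fun t) m * gauss_sum (of_nat (Suc m) * t)"
proof -
  have complete: "gauss_sum t * \<psi> (t * ((\<Sum>a\<in>A. a ^ 2) + (\<Sum>a\<in>A. a) ^ 2)) =
      (\<Sum>y\<in>UNIV. \<psi> (- (of_nat (Suc m) * t) * y ^ 2) * (\<Prod>a\<in>A. \<psi> (t * (a + y) ^ 2)))"
    if "card A = m" for A
  proof -
    define s where "s = (\<Sum>a\<in>A. a)"
    \<comment> \<open>Taking the Gauss sum at -t and recentring it at the element sum s of A
      produces a term - t * s ^ 2, which cancels t * s ^ 2.\<close>
    have "gauss_sum t = (\<Sum>y\<in>UNIV. \<psi> (- t * y ^ 2))"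
      using gauss_sum_minus[of t] by (simp add: gauss_sum_def)
    also have "\<dots> = (\<Sum>y\<in>UNIV. \<psi> (- t * (y - s) ^ 2))"
      by (rule sum.reindex_bij_witness[of _ "\<lambda>y. y - s" "\<lambda>y. y + s"]) auto
    finally have shift: "gauss_sum t = (\<Sum>y\<in>UNIV. \<psi> (- t * (y - s) ^ 2))" .
    \<comment> \<open>Translating A by y absorbs the cross term 2 * t * y * s. Compensating its m
      copies of t * y ^ 2, together with the - t * y ^ 2 already present, gives the factor m +
      1.\<close>
    have "- t * (y - s) ^ 2 + t * ((\<Sum>a\<in>A. a ^ 2) + s ^ 2) =
        - (of_nat (Suc m) * t) * y ^ 2 + (\<Sum>a\<in>A. t * (a + y) ^ 2)" for y
    proof -
      have "(\<Sum>a\<in>A. (a + y) ^ 2) = (\<Sum>a\<in>A. a ^ 2) + 2 * y * s + of_nat m * y ^ 2"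
        by (simp add: power2_sum sum.distrib s_def sum_distrib_left[symmetric]
            sum_distrib_right[symmetric] that)
      then show ?thesis
        unfolding sum_distrib_left[symmetric] by (simp add: power2_eq_square algebra_simps)
    qed
    then show ?thesis
      unfolding shift s_def[symmetric] sum_distrib_right
      by (simp only: \<psi>_add[symmetric] \<psi>_sum[symmetric])
  qed
  have "gauss_sum t * (\<Sum>A | card A = m. \<psi> (t * ((\<Sum>a\<in>A. a ^ 2) + (\<Sum>a\<in>A. a) ^ 2))) =
      (\<Sum>A | card A = m. \<Sum>y\<in>UNIV. \<psi> (- (of_nat (Suc m) * t) * y ^ 2) * (\<Prod>a\<in>A. \<psi> (t * (a + y) ^ 2)))"
    unfolding sum_distrib_left by (intro sum.cong refl complete) simp
  also have "\<dots> = (\<Sum>y\<in>UNIV. \<psi> (- (of_nat (Suc m) * t) * y ^ 2) *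
      (\<Sum>A | card A = m. \<Prod>a\<in>A. \<psi> (t * (a + y) ^ 2)))"
    unfolding sum_distrib_left by (rule sum.swap)
  also have "\<dots> = gauss_sum (- (of_nat (Suc m) * t)) * fps_nth (gen_fun t) m"
    unfolding fps_nth_gen_fun_translate gauss_sum_def sum_distrib_right ..
  finally show ?thesis
    unfolding gauss_sum_minus by (simp only: mult.commute)
qed

text \<open>Cancel \<open>gauss_sum t\<close> in \<open>gauss_sum_mult_quadratic_sum\<close>: if p
  divides m + 1, the other Gauss sum is the one at 0, namely q = p ^ e * p ^ e; otherwise the two
  agree.\<close>

lemma quadratic_sum_gauss_pos:
  assumes "t \<in> gauss_pos"
  shows "(\<Sum>A | card A = m. \<psi> (t * ((\<Sum>a\<in>A. a ^ 2) + (\<Sum>a\<in>A. a) ^ 2))) =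
    (if p dvd Suc m then of_nat (p ^ e) else 1) * of_nat (alpha p e m)"
    (is "?T = _")
proof -
  have g: "gauss_sum t = of_nat (p ^ e)"
    using assms by (simp add: gauss_pos_def)
  have "gauss_sum (of_nat (Suc m) * t) = of_nat (p ^ e) * (if p dvd Suc m then of_nat (p ^ e) else 1)"
  proof (cases "p dvd Suc m")
    case True
    then have "(of_nat (Suc m) :: 'a) = 0"
      by (simp only: of_nat_field_eq_0_iff)
    then have "gauss_sum (of_nat (Suc m) * t) = of_nat (p ^ (2 * e))"
      using gauss_sum_0 by (simp del: of_nat_Suc)
    with True show ?thesis
      by (simp add: power_add mult_2)
  qed (simp add: gauss_sum_of_nat_mult g del: of_nat_Suc)
  then have "of_nat (p ^ e) * ?T =
      of_nat (p ^ e) * ((if p dvd Suc m then of_nat (p ^ e) else 1) * of_nat (alpha p e m))"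
    using gauss_sum_mult_quadratic_sum[of t m]
    unfolding g gen_fun_gauss_pos[OF assms] by (simp only: mult_ac)
  then show ?thesis
    using p_gt_1 by (subst (asm) mult_left_cancel) simp_all
qed

text \<open>Now q = (- p ^ e) * (- p ^ e) leaves the factor - p ^ e, the source of the minus sign
  before \<open>beta\<close> when p divides n.\<close>

lemma quadratic_sum_gauss_neg:
  assumes "t \<in> gauss_neg"
  shows "(\<Sum>A | card A = m. \<psi> (t * ((\<Sum>a\<in>A. a ^ 2) + (\<Sum>a\<in>A. a) ^ 2))) =
    (if p dvd Suc m then - of_nat (p ^ e) else 1) * ((- 1) ^ m * of_int (beta p e m))"
    (is "?T = _")
proof -
  have g: "gauss_sum t = - of_nat (p ^ e)"
    using assms by (simp add: gauss_neg_def)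
  have "gauss_sum (of_nat (Suc m) * t) = - of_nat (p ^ e) * (if p dvd Suc m then - of_nat (p ^ e) else 1)"
  proof (cases "p dvd Suc m")
    case True
    then have "(of_nat (Suc m) :: 'a) = 0"
      by (simp only: of_nat_field_eq_0_iff)
    then have "gauss_sum (of_nat (Suc m) * t) = of_nat (p ^ (2 * e))"
      using gauss_sum_0 by (simp del: of_nat_Suc)
    with True show ?thesis
      by (simp add: power_add mult_2)
  qed (simp add: gauss_sum_of_nat_mult g del: of_nat_Suc)
  then have "- of_nat (p ^ e) * ?T =
      - of_nat (p ^ e) * ((if p dvd Suc m then - of_nat (p ^ e) else 1) * ((- 1) ^ m * of_int (beta p e m)))"
    using gauss_sum_mult_quadratic_sum[of t m]
    unfolding g gen_fun_gauss_neg[OF assms] by (simp only: mult_ac)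
  then show ?thesis
    using p_gt_1 by (subst (asm) mult_left_cancel) simp_all
qed

text \<open>Orthogonality detects the vanishing of the quadratic expression. The term t = 0 yields
  the binomial coefficient, and each sign class consists of (q - 1) / 2 equal terms; the factors 2
  and q clear denominators.\<close>

lemma card_zero_subsets:
  "2 * real (p ^ (2 * e)) * real (card {A :: 'a set. card A = m \<and> (\<Sum>a\<in>A. a ^ 2) + (\<Sum>a\<in>A. a) ^ 2 = 0}) =
    2 * real (p ^ (2 * e) choose m) + (real (p ^ (2 * e)) - 1) *
      (if p dvd Suc m then real (p ^ e) * (real (alpha p e m) - (- 1) ^ m * of_int (beta p e m))
       else real (alpha p e m) + (- 1) ^ m * of_int (beta p e m))"
proof -
  let ?Q = "\<lambda>A :: 'a set. (\<Sum>a\<in>A. a ^ 2) + (\<Sum>a\<in>A. a) ^ 2"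
  let ?T = "\<lambda>t. \<Sum>A | card A = m. \<psi> (t * ?Q A)"
  let ?q = "p ^ (2 * e)"
  have "(\<Sum>t\<in>UNIV. ?T t) = (\<Sum>A | card A = m. \<Sum>t\<in>UNIV. \<psi> (?Q A * t))"
    by (subst sum.swap) (simp only: mult.commute)
  also have "\<dots> = (\<Sum>A | card A = m. if ?Q A = 0 then of_nat ?q else 0)"
    unfolding sum_\<psi>_mult ..
  also have "\<dots> = (\<Sum>A | card A = m \<and> ?Q A = 0. of_nat ?q)"
    by (simp add: sum.If_cases Int_def)
  finally have total: "(\<Sum>t\<in>UNIV. ?T t) = of_nat ?q * of_nat (card {A. card A = m \<and> ?Q A = 0})"
    by (simp add: mult.commute)
  have "card {A. A \<subseteq> (UNIV :: 'a set) \<and> card A = m} = ?q choose m"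
    using n_subsets[of "UNIV :: 'a set" m] by (simp add: card_field)
  then have zero: "?T 0 = of_nat (?q choose m)"
    by simp
  have cpos: "2 * (of_nat (card gauss_pos) :: complex) = of_nat ?q - 1"
    and cneg: "2 * (of_nat (card gauss_neg) :: complex) = of_nat ?q - 1"
  proof -
    \<comment> \<open>Written with \<open>Suc\<close> so that the passage to complex numbers meets
      no truncated subtraction.\<close>
    have "Suc (2 * card gauss_pos) = ?q" "Suc (2 * card gauss_neg) = ?q"
      using card_gauss p_gt_1 by simp_all
    then have "(of_nat (Suc (2 * card gauss_pos)) :: complex) = of_nat ?q"
      "(of_nat (Suc (2 * card gauss_neg)) :: complex) = of_nat ?q"
      by (simp_all only:)
    then show "2 * (of_nat (card gauss_pos) :: complex) = of_nat ?q - 1"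
      "2 * (of_nat (card gauss_neg) :: complex) = of_nat ?q - 1"
      by (simp_all add: algebra_simps)
  qed
  define u v :: complex
    where "u = (if p dvd Suc m then of_nat (p ^ e) else 1) * of_nat (alpha p e m)"
      and "v = (if p dvd Suc m then - of_nat (p ^ e) else 1) * ((- 1) ^ m * of_int (beta p e m))"
  have "2 * (of_nat ?q * of_nat (card {A. card A = m \<and> ?Q A = 0})) =
      2 * (of_nat (?q choose m) + of_nat (card gauss_pos) * u + of_nat (card gauss_neg) * v)"
    unfolding total[symmetric] sum_split_gauss[of ?T] zero u_def v_def
    using quadratic_sum_gauss_pos quadratic_sum_gauss_neg by simp
  also have "\<dots> = 2 * of_nat (?q choose m) + (2 * of_nat (card gauss_pos)) * u + (2 * of_nat (card gauss_neg)) * v"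
    by (simp add: algebra_simps)
  also have "\<dots> = 2 * of_nat (?q choose m) + (of_nat ?q - 1) * (u + v)"
    unfolding cpos cneg by (simp only: distrib_left add.assoc)
  also have "u + v = of_real (if p dvd Suc m
      then real (p ^ e) * (real (alpha p e m) - (- 1) ^ m * of_int (beta p e m))
      else real (alpha p e m) + (- 1) ^ m * of_int (beta p e m))"
    by (simp add: u_def v_def algebra_simps)
  finally have "complex_of_real (2 * real ?q * real (card {A. card A = m \<and> ?Q A = 0})) =
    of_real (2 * real (?q choose m) + (real ?q - 1) *
      (if p dvd Suc m then real (p ^ e) * (real (alpha p e m) - (- 1) ^ m * of_int (beta p e m))
       else real (alpha p e m) + (- 1) ^ m * of_int (beta p e m)))"
    by (simp add: mult.assoc)
  then show ?thesis
    by (rule of_real_eq_iff[THEN iffD1])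
qed

end

section \<open>From tuples to subsets\<close>

lemma sum_square_eq:
  fixes x :: "nat \<Rightarrow> 'a::comm_ring_1"
  shows "(\<Sum>i=1..n. x i) ^ 2 = (\<Sum>i=1..n. x i ^ 2) + 2 * (\<Sum>(i, j) | 1 \<le> i \<and> i < j \<and> j \<le> n. x i * x j)"
proof (induction n)
  case 0
  have empty: "{(i, j). 1 \<le> i \<and> i < j \<and> j \<le> (0::nat)} = {}"
    by auto
  show ?case
    unfolding empty by simp
next
  case (Suc n)
  let ?P = "\<lambda>n::nat. {(i, j). 1 \<le> i \<and> i < j \<and> j \<le> n}"
  have "?P (Suc n) = ?P n \<union> (\<lambda>i. (i, Suc n)) ` {1..n}"
    by auto
  moreover have "finite (?P n)"
    by (rule finite_subset[of _ "{..n} \<times> {..n}"]) auto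
  ultimately have "(\<Sum>(i, j)\<in>?P (Suc n). x i * x j) =
      (\<Sum>(i, j)\<in>?P n. x i * x j) + (\<Sum>(i, j)\<in>(\<lambda>i. (i, Suc n)) ` {1..n}. x i * x j)"
    by (simp only:) (intro sum.union_disjoint; auto)
  also have "(\<Sum>(i, j)\<in>(\<lambda>i. (i, Suc n)) ` {1..n}. x i * x j) = (\<Sum>i=1..n. x i) * x (Suc n)"
    by (subst sum.reindex) (auto simp: inj_on_def sum_distrib_right)
  finally show ?case
    using Suc.IH by (simp add: power2_sum algebra_simps)
qed

text \<open>An injection between finite sets of equal size is onto, so the count of injections into
  A applies.\<close>

lemma card_extensional_bijections:
  assumes "finite S" and "finite A" and "card A = card S"
  shows "card {f \<in> S \<rightarrow>\<^sub>E UNIV. inj_on f S \<and> f ` S = A} = fact (card S)"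
proof -
  have "{f \<in> S \<rightarrow>\<^sub>E UNIV. inj_on f S \<and> f ` S = A} = {f \<in> S \<rightarrow>\<^sub>E A. inj_on f S}"
  proof (intro equalityI subsetI)
    fix f assume f: "f \<in> {f \<in> S \<rightarrow>\<^sub>E A. inj_on f S}"
    then have "f ` S \<subseteq> A" "card (f ` S) = card A"
      using assms by (auto simp: card_image)
    then have "f ` S = A"
      using assms(2) by (intro card_subset_eq)
    with f show "f \<in> {f \<in> S \<rightarrow>\<^sub>E UNIV. inj_on f S \<and> f ` S = A}"
      by (auto simp: PiE_def)
  qed (auto simp: PiE_def)
  then show ?thesis
    using card_inj_on_subset_funcset[OF assms(1,2) order_refl] assms(3) by (simp add: fact_prod_rev)
qed

text \<open>Group the injections by their image. This accounts for the division by a factorial in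
  \<open>M1\<close>.\<close>

lemma card_injections:
  fixes P :: "'b::finite set \<Rightarrow> bool"
  assumes "finite S"
  shows "card {f \<in> S \<rightarrow>\<^sub>E UNIV. inj_on f S \<and> P (f ` S)} = fact (card S) * card {A. card A = card S \<and> P A}"
proof -
  have "{f \<in> S \<rightarrow>\<^sub>E UNIV. inj_on f S \<and> P (f ` S)} =
      (\<Union>A\<in>{A. card A = card S \<and> P A}. {f \<in> S \<rightarrow>\<^sub>E UNIV. inj_on f S \<and> f ` S = A})"
    by (auto simp: card_image)
  then have "card {f \<in> S \<rightarrow>\<^sub>E UNIV. inj_on f S \<and> P (f ` S)} =
      (\<Sum>A | card A = card S \<and> P A. card {f \<in> S \<rightarrow>\<^sub>E UNIV. inj_on f S \<and> f ` S = A})"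
    using finite_PiE[OF assms, of "\<lambda>_. UNIV :: 'b set"]
    by (simp only:) (rule card_UN_disjoint, simp_all, blast)
  also have "\<dots> = (\<Sum>A | card A = card S \<and> P A. fact (card S))"
    using assms by (intro sum.cong refl card_extensional_bijections) auto
  finally show ?thesis
    by simp
qed

text \<open>The vanishing sum forces the last entry to be -s, with s the sum of the others. Then
  twice the sum of products is minus the sum of all squares, of which s ^ 2 is the last, and 2 can
  be cancelled.\<close>

lemma M1_eq_card_zero_subsets:
  assumes "(2 :: 'a::{field,finite}) \<noteq> 0"
  shows "M1 (Suc m) (0 :: 'a) 0 =
    real (card {A :: 'a set. card A = m \<and> (\<Sum>a\<in>A. a ^ 2) + (\<Sum>a\<in>A. a) ^ 2 = 0})"
proof -
  let ?Q = "\<lambda>A :: 'a set. (\<Sum>a\<in>A. a ^ 2) + (\<Sum>a\<in>A. a) ^ 2"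
  let ?M = "M1_tuples (Suc m) (0 :: 'a) 0"
  define F where "F = {f \<in> {1..m} \<rightarrow>\<^sub>E (UNIV :: 'a set). inj_on f {1..m} \<and> ?Q (f ` {1..m}) = 0}"
  have mem_iff: "x \<in> ?M \<longleftrightarrow> x \<in> {1..Suc m} \<rightarrow>\<^sub>E UNIV \<and> inj_on x {1..m} \<and>
      ?Q (x ` {1..m}) = 0 \<and> x (Suc m) = - (\<Sum>i=1..m. x i)" for x :: "nat \<Rightarrow> 'a"
  proof -
    let ?e2 = "\<Sum>(i, j) | 1 \<le> i \<and> i < j \<and> j \<le> Suc m. x i * x j"
    have inj: "(\<forall>i\<in>{1..Suc m - 1}. \<forall>j\<in>{1..Suc m - 1}. i \<noteq> j \<longrightarrow> x i \<noteq> x j) \<longleftrightarrow> inj_on x {1..m}"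
      unfolding inj_on_def by auto
    have sum0: "(\<Sum>i=1..Suc m. x i) = 0 \<longleftrightarrow> x (Suc m) = - (\<Sum>i=1..m. x i)"
      by (simp add: eq_neg_iff_add_eq_0 add.commute)
    have "?e2 = 0 \<longleftrightarrow> ?Q (x ` {1..m}) = 0"
      if "inj_on x {1..m}" and last: "x (Suc m) = - (\<Sum>i=1..m. x i)"
    proof -
      have "(\<Sum>i=1..Suc m. x i) = 0"
        using last sum0 by blast
      then have "2 * ?e2 = - (\<Sum>i=1..Suc m. x i ^ 2)"
        using sum_square_eq[of x "Suc m"] unfolding eq_neg_iff_add_eq_0
        by (simp only: zero_power2 add.commute)
      also have "(\<Sum>i=1..Suc m. x i ^ 2) = ?Q (x ` {1..m})"
        using that by (simp add: sum.reindex)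
      finally have "2 * ?e2 = 0 \<longleftrightarrow> ?Q (x ` {1..m}) = 0"
        by (simp only: neg_equal_0_iff_equal)
      then show ?thesis
        using assms by (simp only: mult_eq_0_iff simp_thms)
    qed
    then show ?thesis
      unfolding M1_tuples_def mem_Collect_eq inj sum0 by blast
  qed
  \<comment> \<open>Restriction forgets only the last entry, which the others determine.\<close>
  have "bij_betw (\<lambda>x. restrict x {1..m}) ?M F"
  proof (rule bij_betw_byWitness[of _ "\<lambda>f. f(Suc m := - (\<Sum>i=1..m. f i))"])
    show "\<forall>x\<in>?M. (restrict x {1..m})(Suc m := - (\<Sum>i=1..m. restrict x {1..m} i)) = x"
    proof
      fix x :: "nat \<Rightarrow> 'a" assume "x \<in> ?M"
      then have x: "x \<in> {1..Suc m} \<rightarrow>\<^sub>E UNIV" "x (Suc m) = - (\<Sum>i=1..m. x i)"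
        unfolding mem_iff by auto
      show "(restrict x {1..m})(Suc m := - (\<Sum>i=1..m. restrict x {1..m} i)) = x"
        using x PiE_arb[OF x(1)] by (auto simp: fun_eq_iff not_le less_Suc_eq_le)
    qed
    show "\<forall>f\<in>F. restrict (f(Suc m := - (\<Sum>i=1..m. f i))) {1..m} = f"
    proof
      fix f assume "f \<in> F"
      then have "f \<in> {1..m} \<rightarrow>\<^sub>E UNIV"
        by (simp add: F_def)
      then show "restrict (f(Suc m := - (\<Sum>i=1..m. f i))) {1..m} = f"
        using PiE_arb[of f "{1..m}"] by (auto simp: fun_eq_iff)
    qed
    show "(\<lambda>x. restrict x {1..m}) ` ?M \<subseteq> F"
    proof (intro image_subsetI)
      fix x :: "nat \<Rightarrow> 'a" assume "x \<in> ?M"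
      then have "inj_on x {1..m}" "?Q (x ` {1..m}) = 0"
        unfolding mem_iff by auto
      then show "restrict x {1..m} \<in> F"
        unfolding F_def mem_Collect_eq inj_on_restrict_eq image_restrict_eq by simp
    qed
    show "(\<lambda>f. f(Suc m := - (\<Sum>i=1..m. f i))) ` F \<subseteq> ?M"
    proof (intro image_subsetI)
      fix f assume f: "f \<in> F"
      let ?x = "f(Suc m := - (\<Sum>i=1..m. f i))"
      have eq: "?x i = f i" if "i \<in> {1..m}" for i
        using that by simp
      have image_eq: "?x ` {1..m} = f ` {1..m}"
        by (rule image_cong[OF refl]) (rule eq)
      have sum_eq: "(\<Sum>i=1..m. ?x i) = (\<Sum>i=1..m. f i)"
        by (rule sum.cong[OF refl]) (rule eq)
      have inj_eq: "inj_on ?x {1..m} \<longleftrightarrow> inj_on f {1..m}"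
        by (rule inj_on_cong) (rule eq)
      have "?x \<in> insert (Suc m) {1..m} \<rightarrow>\<^sub>E UNIV"
        using f by (intro PiE_fun_upd) (simp_all add: F_def)
      moreover have "{1..Suc m} = insert (Suc m) {1..m}"
        by auto
      ultimately show "?x \<in> ?M"
        unfolding mem_iff image_eq sum_eq inj_eq using f by (simp add: F_def)
    qed
  qed
  then have "card ?M = card F"
    by (rule bij_betw_same_card)
  also have "\<dots> = fact m * card {A. card A = m \<and> ?Q A = 0}"
    unfolding F_def using card_injections[of "{1..m}" "\<lambda>A. ?Q A = 0"] by simp
  finally show ?thesis
    by (simp add: M1_def)
qed

theorem theorem4p2:
  fixes p e q n :: nat
  assumes "prime p" and "odd p" and "e \<ge> 1" and "q = p ^ (2 * e)" and "n \<ge> 2"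
    and "CARD('a::{field,finite}) = q"
  shows
    "(\<not> p dvd n \<longrightarrow>
        M1 n (0::'a) 0 =
          1 / real q * real (q choose (n - 1)) +
          (real q - 1) / (2 * real q) *
            (real (alpha p e (n - 1)) + (-1) ^ (n - 1) * real_of_int (beta p e (n - 1)))) \<and>
     (p dvd n \<longrightarrow>
        M1 n (0::'a) 0 =
          1 / real q * real (q choose (n - 1)) +
          (real q - 1) / (2 * sqrt (real q)) *
            (real (alpha p e (n - 1)) - (-1) ^ (n - 1) * real_of_int (beta p e (n - 1))))"
proof -
  obtain m where n: "n = Suc m"
    using assms(5) by (cases n) auto
  obtain \<tau> :: "'a \<Rightarrow> nat" where "\<And>x. \<tau> x < p"
    "\<And>x y. [\<tau> (x + y) = \<tau> x + \<tau> y] (mod p)" "\<exists>x. \<tau> x \<noteq> 0"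
    using exists_additive_functional[of p "2 * e", where 'a='a] assms by auto
  then interpret quadratic_character_sums p e \<tau>
    using assms by unfold_locales auto
  have q0: "real q > 0"
    using assms(4) p_gt_1 by simp
  have sqrt_q: "sqrt (real q) = real (p ^ e)"
    unfolding assms(4) by (intro real_sqrt_unique) (simp_all add: power_mult[symmetric] mult.commute)
  have "real q = real (p ^ e) * real (p ^ e)"
    unfolding assms(4) by (simp add: mult_2 power_add)
  \<comment> \<open>When p divides n, the extra factor p ^ e turns the denominator q into its square
    root.\<close>
  then have inv: "real (p ^ e) / real q = 1 / sqrt (real q)"
    unfolding sqrt_q using p_gt_1 by simp
  have card: "2 * real q * M1 n (0 :: 'a) 0 = 2 * real (q choose m) + (real q - 1) *
      (if p dvd n then real (p ^ e) * (real (alpha p e m) - (- 1) ^ m * of_int (beta p e m))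
       else real (alpha p e m) + (- 1) ^ m * of_int (beta p e m))"
    unfolding n M1_eq_card_zero_subsets[OF two_neq_0] assms(4) by (rule card_zero_subsets)
  show ?thesis
  proof (intro conjI impI)
    assume "\<not> p dvd n"
    then show "M1 n (0 :: 'a) 0 = 1 / real q * real (q choose (n - 1)) + (real q - 1) / (2 * real q) *
        (real (alpha p e (n - 1)) + (- 1) ^ (n - 1) * real_of_int (beta p e (n - 1)))"
      using card q0 by (simp add: n field_simps)
  next
    assume "p dvd n"
    define Y where "Y = real (alpha p e m) - (- 1) ^ m * of_int (beta p e m)"
    have "2 * real q * M1 n (0 :: 'a) 0 = 2 * real (q choose m) + (real q - 1) * (real (p ^ e) * Y)"
      using card \<open>p dvd n\<close> by (simp add: Y_def)
    then have "M1 n (0 :: 'a) 0 = 1 / real q * real (q choose m) + (real q - 1) * real (p ^ e) / (2 * real q) * Y"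
      using q0 by (simp add: field_simps)
    also have "(real q - 1) * real (p ^ e) / (2 * real q) = (real q - 1) / (2 * sqrt (real q))"
      using arg_cong[OF inv, of "\<lambda>z. (real q - 1) / 2 * z"] by simp
    finally show "M1 n (0 :: 'a) 0 = 1 / real q * real (q choose (n - 1)) + (real q - 1) / (2 * sqrt (real q)) *
        (real (alpha p e (n - 1)) - (- 1) ^ (n - 1) * real_of_int (beta p e (n - 1)))"
      by (simp add: n Y_def)
  qed
qed

end
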